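(* Assume that $f\in\ell^{\infty}(X)$, that for all sufficiently large $n$ one has $\hat f_n\in\ell^{\infty}(X)$ almost surely, and that there exist a deterministic sequence $\tau_n\uparrow\infty$ and a Borel measurable $\ell^{\infty}(X)$-valued random element $G$ such that $$\tau_n(\hat f_n-f)\rightsquigarrow G\quad\text{in }\ell^{\infty}(X)$$ in the Hoffmann–Jørgensen sense. For $g\in\ell^\infty(X)$ write $$\iota_f'(g)=\lim_{\varepsilon\downarrow0}\inf_{x\in S^{\varepsilon}}g(x).$$ Then $$\tau_n(\hat\psi_n-\psi^{*})\rightsquigarrow\iota_f'(G)=\lim_{\varepsilon\downarrow0}\inf_{x\in S^{\varepsilon}}G(x).$$ Moreover, $$\tau_n(\hat\psi_n-\psi^{*})-\iota_f'\bigl(\tau_n(\hat f_n-f)\bigr)=o_{\mathbb{P}^{*}}(1).$$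
   Context: Setting. $(\Omega,\mathcal F,\mathbb P)$ is a probability space, $(\Xi,\mathcal G)$ a measurable space, $\xi,\xi_1,\xi_2,\dots$ are i.i.d. $\Xi$-valued random elements on $\Omega$ with law $P$, $X$ is a nonempty set, and $h:X\times\Xi\to\mathbb R$ is such that each section $h_x=h(x,\cdot)$ is measurable and $P$-integrable. Put $f(x)=\mathbb E[h(x,\xi)]$, $\hat f_n(x)=\frac1n\sum_{i=1}^n h(x,\xi_i)$, $\psi^{*}=\inf_{x\in X}f(x)$, $\hat\psi_n=\inf_{x\in X}\hat f_n(x)$, and $S^{\varepsilon}=\{x\in X: f(x)\le\psi^{*}+\varepsilon\}$ for $\varepsilon\ge0$. $\ell^{\infty}(X)$ is the Banach space of bounded real functions on $X$ with the supremum norm $\lVert\cdot\rVert_\infty$. Outer probability. For a possibly nonmeasurable $U:\Omega\to[-\infty,\infty]$, $\mathbb E^{*}U=\inf\{\mathbb E[V]: V\ge U,\ V\text{ measurable},\ \mathbb E[V]\text{ exists}\}$, and $\mathbb P^{*}(A)=\mathbb E^{*}\mathbf 1_A$ for $A\subseteq\Omega$. $U_n=o_{\mathbb P^{*}}(1)$ means $\mathbb P^{*}(|U_n|>\eta)\to0$ for every $\eta>0$. Hoffmann–Jørgensen weak convergence $Y_n\rightsquigarrow Y$ of possibly nonmeasurable maps $Y_n$ into a metric space to a Borel measurable $Y$ means $\mathbb E^{*}\varphi(Y_n)\to\mathbb E\varphi(Y)$ for every bounded continuous real function $\varphi$ on that space. Maps $\hat f_n$ are regarded as $\ell^\infty(X)$-valued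 after modification on a null set. *)

theory Defs
  imports "HOL-Probability.Probability"
begin

section \<open>Outer expectation and Hoffmann-Joergensen weak convergence\<close>

definition expectation_exists :: "'w measure \<Rightarrow> ('w \<Rightarrow> ereal) \<Rightarrow> bool" where
  "expectation_exists M V \<longleftrightarrow>
     (\<integral>\<^sup>+\<omega>. e2ennreal (V \<omega>) \<partial>M) < \<infinity> \<or> (\<integral>\<^sup>+\<omega>. e2ennreal (- V \<omega>) \<partial>M) < \<infinity>"

text \<open>\<^const>\<open>e2ennreal\<close> sends negative numbers to \<open>0\<close>, so the two integrals are those of
  the positive and of the negative part.\<close>

definition ext_expectation :: "'w measure \<Rightarrow> ('w \<Rightarrow> ereal) \<Rightarrow> ereal" where
  "ext_expectation M V =
     enn2ereal (\<integral>\<^sup>+\<omega>. e2ennreal (V \<omega>) \<partial>M) - enn2ereal (\<integral>\<^sup>+\<omega>. e2ennreal (- V \<omega>) \<partial>M)"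

definition outer_expectation :: "'w measure \<Rightarrow> ('w \<Rightarrow> ereal) \<Rightarrow> ereal" where
  "outer_expectation M U =
     Inf {ext_expectation M V | V.
            V \<in> borel_measurable M \<and> expectation_exists M V \<and> (\<forall>\<omega>\<in>space M. U \<omega> \<le> V \<omega>)}"

definition outer_prob :: "'w measure \<Rightarrow> 'w set \<Rightarrow> ereal" where
  "outer_prob M A = outer_expectation M (indicator A)"

definition outer_negligible :: "'w measure \<Rightarrow> (nat \<Rightarrow> 'w \<Rightarrow> real) \<Rightarrow> bool" where
  "outer_negligible M U \<longleftrightarrow>
     (\<forall>\<eta>>0. (\<lambda>n. outer_prob M {\<omega> \<in> space M. \<bar>U n \<omega>\<bar> > \<eta>}) \<longlonglongrightarrow> 0)"

text \<open>The limit variable may live on a probability space \<open>N\<close> of its own; its Borel measurability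
  is part of the notion.\<close>

definition hj_converges ::
    "'w measure \<Rightarrow> (nat \<Rightarrow> 'w \<Rightarrow> 'b::metric_space) \<Rightarrow> 'v measure \<Rightarrow> ('v \<Rightarrow> 'b) \<Rightarrow> bool" where
  "hj_converges M Y N Z \<longleftrightarrow>
     Z \<in> borel_measurable N \<and>
     (\<forall>\<phi> :: 'b \<Rightarrow> real. continuous_on UNIV \<phi> \<and> bounded (range \<phi>) \<longrightarrow>
        (\<lambda>n. outer_expectation M (\<lambda>\<omega>. ereal (\<phi> (Y n \<omega>))))
          \<longlonglongrightarrow> ereal (\<integral>\<omega>. \<phi> (Z \<omega>) \<partial>N))"

section \<open>The space of bounded functions\<close>

text \<open>The nonempty set \<open>X\<close> is the type \<open>'x\<close>. On a discrete space all functions are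
  continuous, so the bounded continuous functions are all bounded functions; the library equips
  them with the supremum norm.\<close>

type_synonym 'x linf = "('x discrete, real) bcontfun"

definition linf_at :: "'x linf \<Rightarrow> 'x \<Rightarrow> real" where
  "linf_at g x = apply_bcontfun g (discrete x)"

text \<open>The value \<open>0\<close> at unbounded functions is the modification of a random function on the
  set where it is not bounded.\<close>

definition linf_of :: "('x \<Rightarrow> real) \<Rightarrow> 'x linf" where
  "linf_of g = (if bounded (range g) then Bcontfun (\<lambda>y. g (of_discrete y)) else 0)"

lemma linf_at_linf_of:
  fixes g :: "'x \<Rightarrow> real"
  assumes "bounded (range g)"
  shows "linf_at (linf_of g) x = g x"
proof -
  have "continuous_on UNIV (\<lambda>y. g (of_discrete y))"
    by (simp add: continuous_on_open_vimage open_discrete)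
  moreover have "bounded (range (\<lambda>y. g (of_discrete y)))"
    using assms by (rule bounded_subset) auto
  ultimately have "(\<lambda>y. g (of_discrete y)) \<in> bcontfun"
    by (simp add: bcontfun_def)
  then show ?thesis
    using assms by (simp add: linf_at_def linf_of_def Bcontfun_inverse discrete_inverse)
qed

lemma bounded_range_linf_at: "bounded (range (linf_at g))"
  unfolding linf_at_def by (rule bounded_subset[OF bounded_apply_bcontfun[of g]]) auto

lemma norm_linf: "norm g = (SUP x. \<bar>linf_at g x\<bar>)"
proof -
  have "range (\<lambda>x. dist (apply_bcontfun g x) 0) = range (\<lambda>x. \<bar>linf_at g x\<bar>)"
    unfolding linf_at_def image_def by (auto simp: dist_real_def) (metis of_discrete_inverse)
  then show ?thesis
    by (simp add: norm_bcontfun_def dist_bcontfun.rep_eq)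
qed

section \<open>Sample average approximation\<close>

text \<open>For \<open>f\<close> bounded below this is the infimum; a value at \<open>f\<close> unbounded below plays no role.\<close>

definition opt_value :: "('x \<Rightarrow> real) \<Rightarrow> real" where
  "opt_value f = (INF x. f x)"

definition near_optimal :: "('x \<Rightarrow> real) \<Rightarrow> real \<Rightarrow> 'x set" where
  "near_optimal f \<epsilon> = {x. f x \<le> opt_value f + \<epsilon>}"

definition inf_deriv :: "('x \<Rightarrow> real) \<Rightarrow> 'x linf \<Rightarrow> real" where
  "inf_deriv f g = Lim (at_right 0) (\<lambda>\<epsilon>. INF x\<in>near_optimal f \<epsilon>. linf_at g x)"

text \<open>\<^const>\<open>Lim\<close> is a description operator; the limit does exist.\<close>

lemma inf_deriv_tendsto:
  fixes f :: "'x \<Rightarrow> real"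
  shows "((\<lambda>\<epsilon>. INF x\<in>near_optimal f \<epsilon>. linf_at g x) \<longlongrightarrow> inf_deriv f g) (at_right 0)"
proof -
  let ?v = "\<lambda>\<epsilon>. INF x\<in>near_optimal f \<epsilon>. linf_at g x"
  obtain B where B: "\<And>x. \<bar>linf_at g x\<bar> \<le> B"
    using bounded_range_linf_at[of g] by (auto simp: bounded_iff)
  have bdd: "bdd_below (linf_at g ` A)" for A
    using B by (intro bdd_belowI[of _ "- B"]) (auto simp: abs_le_iff minus_le_iff)
  have ne: "near_optimal f \<epsilon> \<noteq> {}" if "\<epsilon> > 0" for \<epsilon>
  proof -
    have "Inf (range f) < opt_value f + \<epsilon>"
      using that by (simp add: opt_value_def)
    then obtain x where "f x < opt_value f + \<epsilon>"
      using cInf_lessD[of "range f"] by auto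
    then show ?thesis
      by (auto simp: near_optimal_def intro: less_imp_le)
  qed
  have mono: "?v \<epsilon>' \<le> ?v \<epsilon>" if "0 < \<epsilon>" "\<epsilon> \<le> \<epsilon>'" for \<epsilon> \<epsilon>'
    using that by (intro cINF_superset_mono bdd ne) (auto simp: near_optimal_def)
  have le: "?v \<epsilon> \<le> B" if pos: "\<epsilon> > 0" for \<epsilon>
  proof -
    obtain x where "x \<in> near_optimal f \<epsilon>" using ne[OF pos] by auto
    then have "?v \<epsilon> \<le> linf_at g x" by (intro cINF_lower bdd)
    also have "\<dots> \<le> B" using B[of x] by (simp add: abs_le_iff)
    finally show ?thesis .
  qed
  define L where "L = (SUP \<epsilon>\<in>{0<..}. ?v \<epsilon>)"
  have bdda: "bdd_above (?v ` {0<..})"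
    using le by (intro bdd_aboveI[of _ B]) auto
  have "(?v \<longlongrightarrow> L) (at_right 0)"
  proof (rule order_tendstoI)
    fix a assume "a < L"
    then obtain \<epsilon> where e: "\<epsilon> > 0" "a < ?v \<epsilon>"
      using less_cSUP_iff[OF _ bdda] by (auto simp: L_def)
    have "\<forall>\<^sub>F t in at_right 0. t \<in> {0<..<\<epsilon>}"
      using e(1) by (rule eventually_at_right_real)
    then show "\<forall>\<^sub>F t in at_right 0. a < ?v t"
      by eventually_elim (use e mono[of _ \<epsilon>] in \<open>auto intro: less_le_trans\<close>)
  next
    fix a assume "L < a"
    have "\<forall>\<^sub>F t::real in at_right 0. t > 0"
      by (rule eventually_at_right_less)
    then show "\<forall>\<^sub>F t in at_right 0. ?v t < a"
    proof eventually_elim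
      case (elim t)
      then have "?v t \<le> L"
        unfolding L_def by (intro cSUP_upper bdda) auto
      then show ?case using \<open>L < a\<close> by simp
    qed
  qed
  moreover from this have "inf_deriv f g = L"
    unfolding inf_deriv_def by (intro tendsto_Lim) auto
  ultimately show ?thesis by simp
qed

text \<open>The variable \<open>\<xi> 0\<close> is the generic copy that defines \<open>f\<close>; the sample is
  \<open>\<xi> 1, \<xi> 2, \<dots>\<close>.\<close>

definition objective :: "'w measure \<Rightarrow> ('x \<Rightarrow> 's \<Rightarrow> real) \<Rightarrow> (nat \<Rightarrow> 'w \<Rightarrow> 's) \<Rightarrow> 'x \<Rightarrow> real" where
  "objective M h \<xi> x = (\<integral>\<omega>. h x (\<xi> 0 \<omega>) \<partial>M)"

definition sample_avg :: "('x \<Rightarrow> 's \<Rightarrow> real) \<Rightarrow> (nat \<Rightarrow> 'w \<Rightarrow> 's) \<Rightarrow> nat \<Rightarrow> 'w \<Rightarrow> 'x \<Rightarrow> real" where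
  "sample_avg h \<xi> n \<omega> x = (1 / real n) * (\<Sum>i=1..n. h x (\<xi> i \<omega>))"

definition iid :: "'w measure \<Rightarrow> 's measure \<Rightarrow> 's measure \<Rightarrow> (nat \<Rightarrow> 'w \<Rightarrow> 's) \<Rightarrow> bool" where
  "iid M S P \<xi> \<longleftrightarrow>
     prob_space.indep_vars M (\<lambda>_. S) \<xi> UNIV \<and> (\<forall>i. distr M S (\<xi> i) = P)"

end

theory Submission
  imports Defs
begin

text \<open>The infimum is concave, so for \<open>t \<down> 0\<close> the difference quotients
  \<open>(inf (f + t g) - inf f) / t\<close> increase, with limit the directional derivative. Hence, as soon as
  \<open>1 / \<tau>\<^sub>n \<le> t\<close>, the rescaled optimal value lies between the quotient at the fixed parameter \<open>t\<close>
  and the derivative, both evaluated at the rescaled process. The two bounds are continuous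
  functions of the process, so their limits are given by the hypothesis, and dominated convergence
  as \<open>t \<down> 0\<close> closes the gap.\<close>

section \<open>Outer expectation\<close>

text \<open>A majorant \<open>W\<close> of \<open>V\<close> majorizes \<open>U\<close> too once it
  is raised to infinity on a null set \<open>A\<close> that covers the exceptional points, and this
  leaves both integrals unchanged. The almost sure form is needed because the sample averages are
  bounded only almost surely.\<close>

lemma outer_expectation_mono_AE:
  assumes "AE \<omega> in M. U \<omega> \<le> V \<omega>"
  shows "outer_expectation M U \<le> outer_expectation M V"
  unfolding outer_expectation_def
proof (rule Inf_greatest, clarify)
  fix W assume W: "W \<in> borel_measurable M" "expectation_exists M W" "\<forall>\<omega>\<in>space M. V \<omega> \<le> W \<omega>"
  obtain A where A: "A \<in> null_sets M" "{\<omega> \<in> space M. \<not> U \<omega> \<le> V \<omega>} \<subseteq> A"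
    using assms by (auto simp: eventually_ae_filter)
  define W' where "W' \<omega> = (if \<omega> \<in> A then \<infinity> else W \<omega>)" for \<omega>
  have AE: "AE \<omega> in M. W' \<omega> = W \<omega>"
    using AE_not_in[OF A(1)] by eventually_elim (simp add: W'_def)
  have pos: "(\<integral>\<^sup>+\<omega>. e2ennreal (W' \<omega>) \<partial>M) = (\<integral>\<^sup>+\<omega>. e2ennreal (W \<omega>) \<partial>M)"
    by (rule nn_integral_cong_AE) (use AE in eventually_elim, simp)
  have neg: "(\<integral>\<^sup>+\<omega>. e2ennreal (- W' \<omega>) \<partial>M) = (\<integral>\<^sup>+\<omega>. e2ennreal (- W \<omega>) \<partial>M)"
    by (rule nn_integral_cong_AE) (use AE in eventually_elim, simp)
  have "W' \<in> borel_measurable M"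
    using A(1) W(1) unfolding W'_def by (intro measurable_If_set) auto
  moreover have "expectation_exists M W'" "ext_expectation M W' = ext_expectation M W"
    using W(2) by (simp_all add: expectation_exists_def ext_expectation_def pos neg)
  moreover have "\<forall>\<omega>\<in>space M. U \<omega> \<le> W' \<omega>"
    using A(2) W(3) by (auto simp: W'_def intro: order_trans)
  ultimately show "Inf {ext_expectation M V |V. V \<in> borel_measurable M \<and> expectation_exists M V \<and>
      (\<forall>\<omega>\<in>space M. U \<omega> \<le> V \<omega>)} \<le> ext_expectation M W"
    by (intro Inf_lower CollectI exI[of _ W']) simp
qed

text \<open>All competing majorants dominate an indicator, so their negative parts integrate to
  0.\<close>

lemma outer_prob_nonneg: "0 \<le> outer_prob M A"
  unfolding outer_prob_def outer_expectation_def
proof (rule Inf_greatest, clarify)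
  fix V :: "'a \<Rightarrow> ereal" assume V: "\<forall>\<omega>\<in>space M. indicator A \<omega> \<le> V \<omega>"
  have "(\<integral>\<^sup>+\<omega>. e2ennreal (- V \<omega>) \<partial>M) = (\<integral>\<^sup>+\<omega>. 0 \<partial>M)"
  proof (rule nn_integral_cong)
    fix \<omega> assume "\<omega> \<in> space M"
    have "(0::ereal) \<le> indicator A \<omega>"
      by (simp add: indicator_def)
    also have "\<dots> \<le> V \<omega>"
      using V \<open>\<omega> \<in> space M\<close> by blast
    finally show "e2ennreal (- V \<omega>) = 0"
      by (intro e2ennreal_neg) (simp add: ereal_uminus_le_reorder)
  qed
  then show "0 \<le> ext_expectation M V"
    by (simp add: ext_expectation_def zero_ennreal.rep_eq)
qed

section \<open>Transfer of weak convergence through approximating bounds\<close>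

text \<open>Dominated convergence with the constant \<open>B\<close>, integrable because
  \<open>N\<close> has mass one. Measurability of \<open>u\<close> along \<open>G\<close> comes from
  the pointwise limit, so \<open>u\<close> need not be continuous.\<close>

lemma integral_bounded_tendsto:
  fixes G :: "'v \<Rightarrow> 'b::topological_space" and U :: "nat \<Rightarrow> 'b \<Rightarrow> real"
  assumes "prob_space N" and G: "G \<in> borel_measurable N"
    and cont: "\<And>k. continuous_on UNIV (U k)" and bound: "\<And>k g. \<bar>U k g\<bar> \<le> B"
    and lim: "\<And>g. (\<lambda>k. U k g) \<longlonglongrightarrow> u g"
  shows "(\<lambda>k. \<integral>\<omega>. U k (G \<omega>) \<partial>N) \<longlonglongrightarrow> (\<integral>\<omega>. u (G \<omega>) \<partial>N)"
proof -
  interpret prob_space N by fact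
  have meas: "(\<lambda>\<omega>. U k (G \<omega>)) \<in> borel_measurable N" for k
    using borel_measurable_continuous_onI[OF cont] G by (rule measurable_compose_rev)
  show ?thesis
  proof (rule integral_dominated_convergence[where w = "\<lambda>_. B"])
    show "(\<lambda>\<omega>. u (G \<omega>)) \<in> borel_measurable N"
      using lim meas by (rule borel_measurable_LIMSEQ_real)
  qed (use lim bound meas in auto)
qed

text \<open>The order of choices matters: first \<open>k\<close> is fixed so that the integral of
  \<open>U k\<close> already lies below \<open>c\<close>, then \<open>n\<close> grows. For that
  \<open>k\<close> weak convergence applies to the bounded continuous \<open>U k\<close>, and
  monotonicity passes the bound to \<open>T n\<close>, which may be nonmeasurable.\<close>

lemma hj_eventually_less:
  assumes hj: "hj_converges M Y N G" and N: "prob_space N"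
    and cont: "\<And>k. continuous_on UNIV (U k)" and bound: "\<And>k g. \<bar>U k g\<bar> \<le> B"
    and lim: "\<And>g. (\<lambda>k. U k g) \<longlonglongrightarrow> u g"
    and le: "\<And>k. \<forall>\<^sub>F n in sequentially. AE \<omega> in M. T n \<omega> \<le> ereal (U k (Y n \<omega>))"
    and c: "ereal (\<integral>\<omega>. u (G \<omega>) \<partial>N) < c"
  shows "\<forall>\<^sub>F n in sequentially. outer_expectation M (T n) < c"
proof -
  have "(\<lambda>k. ereal (\<integral>\<omega>. U k (G \<omega>) \<partial>N)) \<longlonglongrightarrow> ereal (\<integral>\<omega>. u (G \<omega>) \<partial>N)"
    by (intro tendsto_ereal integral_bounded_tendsto[OF N _ cont bound lim])
      (use hj in \<open>simp add: hj_converges_def\<close>)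
  from order_tendstoD(2)[OF this c] obtain k where k: "ereal (\<integral>\<omega>. U k (G \<omega>) \<partial>N) < c"
    by (auto simp: eventually_sequentially)
  have "bounded (range (U k))"
    using bound by (auto simp: bounded_iff)
  then have "(\<lambda>n. outer_expectation M (\<lambda>\<omega>. ereal (U k (Y n \<omega>))))
      \<longlonglongrightarrow> ereal (\<integral>\<omega>. U k (G \<omega>) \<partial>N)"
    using hj cont by (simp add: hj_converges_def)
  from order_tendstoD(2)[OF this k] le[of k] show ?thesis
    by eventually_elim (erule le_less_trans[OF outer_expectation_mono_AE])
qed

text \<open>Negating \<open>T\<close> in the upper bound would turn the outer expectation into an
  inner one, so the argument is repeated with reversed inequalities. It still works because the
  outer expectation is monotone.\<close>

lemma hj_eventually_greater:
  assumes hj: "hj_converges M Y N G" and N: "prob_space N"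
    and cont: "\<And>k. continuous_on UNIV (U k)" and bound: "\<And>k g. \<bar>U k g\<bar> \<le> B"
    and lim: "\<And>g. (\<lambda>k. U k g) \<longlonglongrightarrow> u g"
    and le: "\<And>k. \<forall>\<^sub>F n in sequentially. AE \<omega> in M. ereal (U k (Y n \<omega>)) \<le> T n \<omega>"
    and c: "c < ereal (\<integral>\<omega>. u (G \<omega>) \<partial>N)"
  shows "\<forall>\<^sub>F n in sequentially. c < outer_expectation M (T n)"
proof -
  have "(\<lambda>k. ereal (\<integral>\<omega>. U k (G \<omega>) \<partial>N)) \<longlonglongrightarrow> ereal (\<integral>\<omega>. u (G \<omega>) \<partial>N)"
    by (intro tendsto_ereal integral_bounded_tendsto[OF N _ cont bound lim])
      (use hj in \<open>simp add: hj_converges_def\<close>)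
  from order_tendstoD(1)[OF this c] obtain k where k: "c < ereal (\<integral>\<omega>. U k (G \<omega>) \<partial>N)"
    by (auto simp: eventually_sequentially)
  have "bounded (range (U k))"
    using bound by (auto simp: bounded_iff)
  then have "(\<lambda>n. outer_expectation M (\<lambda>\<omega>. ereal (U k (Y n \<omega>))))
      \<longlonglongrightarrow> ereal (\<integral>\<omega>. U k (G \<omega>) \<partial>N)"
    using hj cont by (simp add: hj_converges_def)
  from order_tendstoD(1)[OF this k] le[of k] show ?thesis
    by eventually_elim (erule less_le_trans, erule outer_expectation_mono_AE)
qed

section \<open>Suprema over segments\<close>

text \<open>A test function need not be monotone, so bounds on a number bound its image only through
  the extreme values between them. The parameter \<open>s\<close> ranges over a fixed compact set,
  which does not move with the endpoints and is nonempty in either order of them.\<close>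

definition segment_sup :: "(real \<Rightarrow> real) \<Rightarrow> real \<times> real \<Rightarrow> real" where
  "segment_sup \<phi> p = (SUP s\<in>{0..1}. \<phi> (fst p + s * (snd p - fst p)))"

lemma segment_sup_diag [simp]: "segment_sup \<phi> (a, a) = \<phi> a"
  by (simp add: segment_sup_def)

context
  fixes \<phi> :: "real \<Rightarrow> real" and B :: real
  assumes bound: "\<And>z. \<bar>\<phi> z\<bar> \<le> B"
begin

lemma bdd_above_segment: "bdd_above ((\<lambda>s. \<phi> (a + s * b)) ` A)"
  using bound by (intro bdd_aboveI[of _ B]) (auto simp: abs_le_iff)

lemma le_segment_sup:
  assumes "a \<le> z" "z \<le> b"
  shows "\<phi> z \<le> segment_sup \<phi> (a, b)"
proof -
  obtain s where s: "s \<in> {0..1}" "z = a + s * (b - a)"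
  proof (cases "a = b")
    case False
    with assms show ?thesis
      by (intro that[of "(z - a) / (b - a)"]) (auto simp: divide_simps)
  qed (use assms that[of 0] in auto)
  then show ?thesis
    unfolding segment_sup_def by (auto intro!: cSUP_upper2[OF bdd_above_segment])
qed

lemma abs_segment_sup_le: "\<bar>segment_sup \<phi> p\<bar> \<le> B"
proof -
  have "segment_sup \<phi> p \<le> B"
    unfolding segment_sup_def using bound by (intro cSUP_least) (auto simp: abs_le_iff)
  moreover have "\<phi> (fst p) \<le> segment_sup \<phi> p"
    unfolding segment_sup_def by (rule cSUP_upper2[OF bdd_above_segment, of 0]) auto
  ultimately show ?thesis
    using bound[of "fst p"] by (simp add: abs_le_iff)
qed

text \<open>Compactness of the parameter interval makes \<open>F (q, s)\<close> close to
  \<open>F (p, s)\<close> uniformly in \<open>s\<close> for \<open>q\<close> near \<open>p\<close>.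
  A uniform bound on the difference passes to the suprema, one direction at a time by
  \<open>upper\<close>; it holds only weakly there, hence \<open>e / 2\<close>.\<close>

lemma continuous_on_segment_sup:
  assumes cont: "continuous_on UNIV \<phi>"
  shows "continuous_on UNIV (segment_sup \<phi>)"
proof -
  define F where "F = (\<lambda>q :: (real \<times> real) \<times> real.
    \<phi> (fst (fst q) + snd q * (snd (fst q) - fst (fst q))))"
  have F: "continuous_on (UNIV \<times> {0..1}) F"
    unfolding F_def by (intro continuous_on_compose2[OF cont] continuous_intros) auto
  have sup: "segment_sup \<phi> p = (SUP s\<in>{0..1}. F (p, s))" for p
    by (simp add: segment_sup_def F_def)
  have bdd: "bdd_above ((\<lambda>s. F (p, s)) ` {0..1})" for p
    by (simp add: F_def bdd_above_segment)
  have upper: "segment_sup \<phi> p \<le> segment_sup \<phi> q + e"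
    if "\<And>s. s \<in> {0..1} \<Longrightarrow> F (p, s) \<le> F (q, s) + e" for p q e
    unfolding sup[of p]
  proof (rule cSUP_least)
    fix s :: real assume s: "s \<in> {0..1}"
    have "F (q, s) \<le> segment_sup \<phi> q"
      unfolding sup using s by (rule cSUP_upper[OF _ bdd])
    with that[OF s] show "F (p, s) \<le> segment_sup \<phi> q + e" by simp
  qed simp
  show ?thesis
    unfolding continuous_on_eq_continuous_within
  proof (intro ballI)
    fix p :: "real \<times> real"
    show "isCont (segment_sup \<phi>) p"
      unfolding isCont_def tendsto_iff
    proof (intro allI impI)
      fix e :: real assume "e > 0"
      then have "e / 2 > 0" by simp
      then obtain X0 where X0: "p \<in> X0" "open X0"
        "\<forall>x\<in>X0 \<inter> UNIV. \<forall>s\<in>{0..1}. dist (F (x, s)) (F (p, s)) \<le> e / 2"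
        using continuous_on_prod_compactE[OF F compact_Icc UNIV_I] by metis
      have "dist (segment_sup \<phi> q) (segment_sup \<phi> p) < e" if "q \<in> X0" for q
      proof -
        have d: "\<bar>F (q, s) - F (p, s)\<bar> \<le> e / 2" if "s \<in> {0..1}" for s
          using X0(3) \<open>q \<in> X0\<close> that by (auto simp: dist_real_def)
        have "segment_sup \<phi> q \<le> segment_sup \<phi> p + e / 2"
          by (rule upper) (drule d, linarith)
        moreover have "segment_sup \<phi> p \<le> segment_sup \<phi> q + e / 2"
          by (rule upper) (drule d, linarith)
        ultimately show ?thesis using \<open>e > 0\<close> by (simp add: dist_real_def abs_if)
      qed
      then show "\<forall>\<^sub>F q in at p. dist (segment_sup \<phi> q) (segment_sup \<phi> p) < e"
        using X0(1,2) by (auto simp: eventually_at_topological)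
    qed
  qed
qed

end

section \<open>The directional derivative of the infimum\<close>

lemma abs_linf_at_le: "\<bar>linf_at g x\<bar> \<le> norm g"
  using norm_bounded[of g "discrete x"] by (simp add: linf_at_def)

lemma linf_at_diff: "linf_at (g - g') x = linf_at g x - linf_at g' x"
  by (simp add: linf_at_def minus_bcontfun.rep_eq)

lemma linf_at_scaleR: "linf_at (c *\<^sub>R g) x = c * linf_at g x"
  by (simp add: linf_at_def scaleR_bcontfun.rep_eq)

lemma bdd_below_linf_at: "bdd_below (linf_at g ` A)"
  by (rule bdd_belowI2[of _ "- norm g"]) (metis abs_linf_at_le abs_le_D2 minus_le_iff)

lemma opt_value_le: "bounded (range u) \<Longrightarrow> opt_value u \<le> u x"
  unfolding opt_value_def by (intro cINF_lower bounded_imp_bdd_below) auto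

lemma opt_value_greatest: "(\<And>x. c \<le> u x) \<Longrightarrow> c \<le> opt_value u"
  unfolding opt_value_def by (intro cINF_greatest) auto

text \<open>The infimum need not be attained, so a positive tolerance is what guarantees a
  point.\<close>

lemma near_optimal_nonempty:
  assumes "\<epsilon> > 0"
  shows "near_optimal f \<epsilon> \<noteq> {}"
proof -
  have "Inf (range f) < opt_value f + \<epsilon>"
    using assms by (simp add: opt_value_def)
  then obtain x where "f x < opt_value f + \<epsilon>"
    using cInf_lessD[of "range f"] by auto
  then show ?thesis
    by (auto simp: near_optimal_def intro: less_imp_le)
qed

text \<open>Shrinking the tolerance shrinks the set and raises the infimum, so the limit dominates
  each term.\<close>

lemma INF_near_optimal_le_inf_deriv:
  assumes "\<epsilon> > 0"
  shows "(INF x\<in>near_optimal f \<epsilon>. linf_at g x) \<le> inf_deriv f g"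
proof (rule tendsto_lowerbound[OF inf_deriv_tendsto])
  have "\<forall>\<^sub>F t in at_right 0. t \<in> {0<..<\<epsilon>}"
    using assms by (rule eventually_at_right_real)
  then show "\<forall>\<^sub>F t in at_right 0.
      (INF x\<in>near_optimal f \<epsilon>. linf_at g x) \<le> (INF x\<in>near_optimal f t. linf_at g x)"
    by eventually_elim
      (intro cINF_superset_mono bdd_below_linf_at near_optimal_nonempty, auto simp: near_optimal_def)
qed simp

section \<open>Difference quotients of the infimum in a fixed direction\<close>

definition inf_quot :: "('x \<Rightarrow> real) \<Rightarrow> real \<Rightarrow> 'x linf \<Rightarrow> real" where
  "inf_quot f t g = (opt_value (\<lambda>x. f x + t * linf_at g x) - opt_value f) / t"

context
  fixes f :: "'x \<Rightarrow> real"
  assumes bounded_f: "bounded (range f)"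
begin

lemma bounded_perturbation: "bounded (range (\<lambda>x. f x + t * linf_at g x))"
  using bounded_plus_comp[OF bounded_f bounded_range_linf_at[of "t *\<^sub>R g"]]
  by (simp add: linf_at_scaleR)

text \<open>This is concavity of the infimum: with \<open>a = s / t\<close>, the function
  \<open>f + s g\<close> is the convex combination of \<open>f\<close> and \<open>f + t g\<close>
  with weights \<open>1 - a\<close> and \<open>a\<close>.\<close>

lemma inf_quot_antimono:
  assumes "0 < s" "s \<le> t"
  shows "inf_quot f t g \<le> inf_quot f s g"
proof -
  define a where "a = s / t"
  have a: "0 < a" "a \<le> 1" "a * t = s"
    using assms by (auto simp: a_def)
  have "(1 - a) * opt_value f + a * opt_value (\<lambda>x. f x + t * linf_at g x) \<le> f x + s * linf_at g x" for x
  proof -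
    have "(1 - a) * opt_value f + a * opt_value (\<lambda>x. f x + t * linf_at g x)
        \<le> (1 - a) * f x + a * (f x + t * linf_at g x)"
      using a by (intro add_mono mult_left_mono opt_value_le bounded_f
          opt_value_le[OF bounded_perturbation]) auto
    also have "\<dots> = f x + s * linf_at g x"
      using a(3)[symmetric] by (simp add: algebra_simps)
    finally show ?thesis .
  qed
  then have "(1 - a) * opt_value f + a * opt_value (\<lambda>x. f x + t * linf_at g x)
      \<le> opt_value (\<lambda>x. f x + s * linf_at g x)"
    by (rule opt_value_greatest)
  then have "a * (opt_value (\<lambda>x. f x + t * linf_at g x) - opt_value f)
      \<le> opt_value (\<lambda>x. f x + s * linf_at g x) - opt_value f"
    by (simp add: algebra_simps)
  then have "a * (opt_value (\<lambda>x. f x + t * linf_at g x) - opt_value f) / s \<le> inf_quot f s g"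
    using assms by (simp add: inf_quot_def divide_right_mono)
  then show ?thesis
    using assms by (simp add: inf_quot_def a_def)
qed

text \<open>A nearly optimal point of \<open>f\<close> at which \<open>g\<close> is hardly above the
  derivative serves as a test point in the infimum of \<open>f + t g\<close>.\<close>

lemma inf_quot_le_inf_deriv:
  assumes "t > 0"
  shows "inf_quot f t g \<le> inf_deriv f g"
proof -
  have "opt_value (\<lambda>x. f x + t * linf_at g x) \<le> opt_value f + t * inf_deriv f g + e" if "e > 0" for e
  proof -
    \<comment> \<open>The test point loses \<epsilon> in \<open>f\<close> and \<open>t\<close> times
      \<epsilon> in \<open>g\<close>; together these losses equal \<open>e\<close>.\<close>
    define \<epsilon> where "\<epsilon> = e / (1 + t)"
    have "(1 + t) * \<epsilon> = e"
      using assms by (simp add: \<epsilon>_def)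
    then have \<epsilon>: "\<epsilon> > 0" "\<epsilon> + t * \<epsilon> = e"
      using assms that by (simp add: \<epsilon>_def, simp add: distrib_right)
    have "(INF x\<in>near_optimal f \<epsilon>. linf_at g x) < inf_deriv f g + \<epsilon>"
      using INF_near_optimal_le_inf_deriv[OF \<epsilon>(1), of g f] \<epsilon>(1) by linarith
    then obtain x where x: "x \<in> near_optimal f \<epsilon>" "linf_at g x < inf_deriv f g + \<epsilon>"
      using cInf_lessD[of "linf_at g ` near_optimal f \<epsilon>"] near_optimal_nonempty[OF \<epsilon>(1), of f] by auto
    have "opt_value (\<lambda>x. f x + t * linf_at g x) \<le> f x + t * linf_at g x"
      by (rule opt_value_le[OF bounded_perturbation])
    also have "\<dots> \<le> opt_value f + \<epsilon> + t * (inf_deriv f g + \<epsilon>)"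
      using x assms by (intro add_mono mult_left_mono) (auto simp: near_optimal_def)
    finally show ?thesis using \<epsilon>(2) by (simp add: algebra_simps)
  qed
  then have "opt_value (\<lambda>x. f x + t * linf_at g x) \<le> opt_value f + t * inf_deriv f g"
    by (rule field_le_epsilon)
  then show ?thesis
    using assms by (simp add: inf_quot_def field_simps)
qed

text \<open>Inside the near-optimal set the bound holds summand by summand. Outside it
  \<open>f\<close> exceeds the optimal value by more than \<epsilon>, while \<open>t g\<close> and
  \<open>t ?v\<close> can differ unfavourably by at most \<open>2 * t * norm g\<close>, which is no
  larger.\<close>

lemma inf_quot_ge_INF:
  assumes "t > 0" "2 * t * norm g \<le> \<epsilon>" "\<epsilon> > 0"
  shows "(INF x\<in>near_optimal f \<epsilon>. linf_at g x) \<le> inf_quot f t g"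
proof -
  let ?v = "INF x\<in>near_optimal f \<epsilon>. linf_at g x"
  have v: "?v \<le> norm g"
  proof -
    obtain x where "x \<in> near_optimal f \<epsilon>"
      using near_optimal_nonempty[OF assms(3), of f] by auto
    then have "?v \<le> linf_at g x" by (rule cINF_lower[OF bdd_below_linf_at])
    then show ?thesis using abs_linf_at_le[of g x] by simp
  qed
  have "opt_value f + t * ?v \<le> f x + t * linf_at g x" for x
  proof (cases "x \<in> near_optimal f \<epsilon>")
    case True
    then show ?thesis
      using assms(1) by (intro add_mono mult_left_mono opt_value_le[OF bounded_f]
          cINF_lower[OF bdd_below_linf_at]) auto
  next
    case False
    have "t * ?v \<le> t * norm g" "t * (- norm g) \<le> t * linf_at g x"
      using assms(1) v abs_linf_at_le[of g x] by (intro mult_left_mono; simp add: abs_le_iff)+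
    with False assms(2) show ?thesis by (simp add: near_optimal_def)
  qed
  then have "opt_value f + t * ?v \<le> opt_value (\<lambda>x. f x + t * linf_at g x)"
    by (rule opt_value_greatest)
  then show ?thesis
    using assms(1) by (simp add: inf_quot_def field_simps)
qed

lemma inf_quot_tendsto_inf_deriv: "((\<lambda>t. inf_quot f t g) \<longlongrightarrow> inf_deriv f g) (at_right 0)"
proof (rule tendsto_sandwich)
  \<comment> \<open>The extra \<open>t\<close> keeps the tolerance positive when \<open>g\<close> is
    zero.\<close>
  let ?r = "\<lambda>t::real. 2 * t * norm g + t"
  have "(?r \<longlongrightarrow> 2 * 0 * norm g + 0) (at_right 0)"
    by (intro tendsto_intros)
  moreover have "\<forall>\<^sub>F t in at_right 0. ?r t > 0"
    using eventually_at_right_less[of 0] by eventually_elim (simp add: add_nonneg_pos)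
  ultimately have "filterlim ?r (at_right 0) (at_right 0)"
    by (intro tendsto_imp_filterlim_at_right) simp_all
  with inf_deriv_tendsto[where f = f and g = g]
  show "((\<lambda>t. INF x\<in>near_optimal f (?r t). linf_at g x) \<longlongrightarrow> inf_deriv f g) (at_right 0)"
    by (rule filterlim_compose)
  show "\<forall>\<^sub>F t in at_right 0. (INF x\<in>near_optimal f (?r t). linf_at g x) \<le> inf_quot f t g"
    using eventually_at_right_less[of 0]
    by eventually_elim (intro inf_quot_ge_INF, auto simp: add_nonneg_pos)
  show "\<forall>\<^sub>F t in at_right 0. inf_quot f t g \<le> inf_deriv f g"
    using eventually_at_right_less[of 0] by eventually_elim (rule inf_quot_le_inf_deriv)
qed simp

text \<open>Changing \<open>g\<close> moves the perturbed function by at most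
  \<open>t * norm (g - g')\<close>, and the division by \<open>t\<close> cancels the factor. The
  constant 1 does not depend on \<open>t\<close>, so it survives the passage to the
  derivative.\<close>

lemma inf_quot_Lipschitz:
  assumes "t > 0"
  shows "\<bar>inf_quot f t g - inf_quot f t g'\<bar> \<le> norm (g - g')"
proof -
  have le: "inf_quot f t g \<le> inf_quot f t g' + norm (g - g')" for g g'
  proof -
    have "opt_value (\<lambda>x. f x + t * linf_at g x) - t * norm (g - g') \<le> f x + t * linf_at g' x" for x
    proof -
      have "opt_value (\<lambda>x. f x + t * linf_at g x) \<le> f x + t * linf_at g x"
        by (rule opt_value_le[OF bounded_perturbation])
      moreover have "linf_at g x \<le> linf_at g' x + norm (g - g')"
        using abs_linf_at_le[of "g - g'" x] by (simp add: linf_at_diff)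
      then have "t * linf_at g x \<le> t * (linf_at g' x + norm (g - g'))"
        using assms by (simp add: mult_left_mono)
      ultimately show ?thesis by (simp add: algebra_simps)
    qed
    then have "opt_value (\<lambda>x. f x + t * linf_at g x) - t * norm (g - g')
        \<le> opt_value (\<lambda>x. f x + t * linf_at g' x)"
      by (rule opt_value_greatest)
    then show ?thesis
      using assms by (simp add: inf_quot_def field_simps)
  qed
  show ?thesis
    using le[of g g'] le[of g' g] by (simp add: norm_minus_commute)
qed

lemma inf_deriv_Lipschitz: "\<bar>inf_deriv f g - inf_deriv f g'\<bar> \<le> norm (g - g')"
proof (rule tendsto_upperbound)
  show "((\<lambda>t. \<bar>inf_quot f t g - inf_quot f t g'\<bar>) \<longlongrightarrow> \<bar>inf_deriv f g - inf_deriv f g'\<bar>) (at_right 0)"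
    by (intro tendsto_intros inf_quot_tendsto_inf_deriv)
  show "\<forall>\<^sub>F t in at_right 0. \<bar>inf_quot f t g - inf_quot f t g'\<bar> \<le> norm (g - g')"
    using eventually_at_right_less[of 0] by eventually_elim (rule inf_quot_Lipschitz)
qed simp

lemma continuous_on_inf_quot:
  assumes "t > 0"
  shows "continuous_on A (inf_quot f t)"
  by (rule lipschitz_on_continuous_on[of 1])
    (use inf_quot_Lipschitz[OF assms] in \<open>auto simp: lipschitz_on_def dist_norm\<close>)

lemma continuous_on_inf_deriv: "continuous_on A (inf_deriv f)"
  by (rule lipschitz_on_continuous_on[of 1])
    (use inf_deriv_Lipschitz in \<open>auto simp: lipschitz_on_def dist_norm\<close>)

text \<open>Perturbing \<open>f\<close> by \<open>1 / c\<close> times the rescaled difference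
  restores \<open>u\<close> exactly. Boundedness of \<open>u\<close> is essential here, since
  \<open>linf_of\<close> sends unbounded functions to 0.\<close>

lemma scaled_opt_value_diff:
  assumes "bounded (range u)" "c > 0"
  shows "c * (opt_value u - opt_value f) = inf_quot f (1 / c) (c *\<^sub>R (linf_of u - linf_of f))"
proof -
  have "(\<lambda>x. f x + 1 / c * linf_at (c *\<^sub>R (linf_of u - linf_of f)) x) = u"
    using assms by (simp add: linf_at_scaleR linf_at_diff linf_at_linf_of bounded_f)
  then show ?thesis
    by (simp add: inf_quot_def mult.commute)
qed

end

section \<open>Weak limit and first-order expansion of the optimal value\<close>

theorem theorem4p4:
  fixes M :: "'w measure" and S P :: "'s measure" and N :: "'v measure"
    and \<xi> :: "nat \<Rightarrow> 'w \<Rightarrow> 's" and h :: "'x \<Rightarrow> 's \<Rightarrow> real"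
    and \<tau> :: "nat \<Rightarrow> real" and G :: "'v \<Rightarrow> 'x linf"
  defines "f \<equiv> objective M h \<xi>"
  defines "fhat \<equiv> sample_avg h \<xi>"
  assumes "prob_space M"
    and "iid M S P \<xi>"
    and "\<And>x. integrable P (h x)"
    and "bounded (range f)"
    and "\<forall>\<^sub>F n in sequentially. AE \<omega> in M. bounded (range (fhat n \<omega>))"
    and "mono_on {1..} \<tau>" and "filterlim \<tau> at_top sequentially"
    and "prob_space N" and "G \<in> borel_measurable N"
    and "hj_converges M (\<lambda>n \<omega>. \<tau> n *\<^sub>R (linf_of (fhat n \<omega>) - linf_of f)) N G"
  shows "hj_converges M (\<lambda>n \<omega>. \<tau> n * (opt_value (fhat n \<omega>) - opt_value f)) N
           (\<lambda>\<omega>. inf_deriv f (G \<omega>))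
       \<and> outer_negligible M
           (\<lambda>n \<omega>. \<tau> n * (opt_value (fhat n \<omega>) - opt_value f)
                  - inf_deriv f (\<tau> n *\<^sub>R (linf_of (fhat n \<omega>) - linf_of f)))"
proof -
  note bf = \<open>bounded (range f)\<close> and hj = assms(12) and N = \<open>prob_space N\<close>
  define Y where "Y = (\<lambda>n \<omega>. \<tau> n *\<^sub>R (linf_of (fhat n \<omega>) - linf_of f))"
  define Z where "Z = (\<lambda>n \<omega>. \<tau> n * (opt_value (fhat n \<omega>) - opt_value f))"
  \<comment> \<open>\<open>Suc k\<close> keeps the step of the quotient positive and finite for
    every \<open>k\<close>.\<close>
  define q where "q k = inf_quot f (1 / real (Suc k))" for k
  note hjY = hj[folded Y_def]
  \<comment> \<open>\<open>Z n\<close> is the quotient at step \<open>1 / \<tau> n\<close>. Once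
    \<open>\<tau> n\<close> reaches \<open>Suc k\<close>, this step is at most that of
    \<open>q k\<close>, and antitonicity gives the lower bound.\<close>
  have bracket: "\<forall>\<^sub>F n in sequentially. AE \<omega> in M.
      q k (Y n \<omega>) \<le> Z n \<omega> \<and> Z n \<omega> \<le> inf_deriv f (Y n \<omega>)" for k
  proof -
    have "\<forall>\<^sub>F n in sequentially. real (Suc k) \<le> \<tau> n"
      using \<open>filterlim \<tau> at_top sequentially\<close> by (simp only: filterlim_at_top)
    with assms(7) show ?thesis
    proof eventually_elim
      case (elim n)
      have pos: "\<tau> n > 0" using elim(2) by simp
      have step: "1 / \<tau> n \<le> 1 / real (Suc k)"
        using elim(2) by (intro divide_left_mono) (use pos in auto)
      from elim(1) show ?case
      proof eventually_elim
        case (elim \<omega>)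
        then have "Z n \<omega> = inf_quot f (1 / \<tau> n) (Y n \<omega>)"
          unfolding Z_def Y_def using pos by (rule scaled_opt_value_diff[OF bf])
        then show ?case
          unfolding q_def using pos step
          by (simp only:) (intro conjI inf_quot_antimono[OF bf] inf_quot_le_inf_deriv[OF bf], auto)
      qed
    qed
  qed
  have cont_q: "continuous_on UNIV (q k)" for k
    unfolding q_def by (rule continuous_on_inf_quot[OF bf]) simp
  note cont_d = continuous_on_inf_deriv[OF bf]
  have q_lim: "(\<lambda>k. q k g) \<longlonglongrightarrow> inf_deriv f g" for g
    unfolding q_def
  proof (rule filterlim_compose[OF inf_quot_tendsto_inf_deriv[OF bf]])
    show "filterlim (\<lambda>k. 1 / real (Suc k)) (at_right 0) sequentially"
      using LIMSEQ_inverse_real_of_nat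
      by (intro tendsto_imp_filterlim_at_right) (simp_all add: inverse_eq_divide)
  qed
  have q_le: "q k g \<le> inf_deriv f g" for k g
    unfolding q_def by (rule inf_quot_le_inf_deriv[OF bf]) simp

  have seg_cont: "continuous_on UNIV (\<lambda>g. segment_sup \<phi> (q k g, inf_deriv f g))"
    if "continuous_on UNIV \<phi>" "\<And>z. \<bar>\<phi> z\<bar> \<le> B" for \<phi> B k
    by (intro continuous_on_compose2[OF continuous_on_segment_sup[OF that(2,1)]]
        continuous_on_Pair cont_q cont_d) auto
  \<comment> \<open>The two endpoints merge as \<open>k\<close> grows, and the supremum over a
    degenerate segment is the value of \<phi>.\<close>
  have seg_lim: "(\<lambda>k. segment_sup \<phi> (q k g, inf_deriv f g)) \<longlonglongrightarrow> \<phi> (inf_deriv f g)"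
    if "continuous_on UNIV \<phi>" "\<And>z. \<bar>\<phi> z\<bar> \<le> B" for \<phi> B g
  proof -
    have "(\<lambda>k. segment_sup \<phi> (q k g, inf_deriv f g))
        \<longlonglongrightarrow> segment_sup \<phi> (inf_deriv f g, inf_deriv f g)"
      by (rule continuous_on_tendsto_compose[OF continuous_on_segment_sup[OF that(2,1)]])
        (auto intro!: tendsto_Pair q_lim)
    then show ?thesis by simp
  qed

  have conv: "hj_converges M Z N (\<lambda>\<omega>. inf_deriv f (G \<omega>))"
    unfolding hj_converges_def
  proof (intro conjI allI impI)
    show "(\<lambda>\<omega>. inf_deriv f (G \<omega>)) \<in> borel_measurable N"
      using borel_measurable_continuous_onI[OF cont_d] \<open>G \<in> borel_measurable N\<close>
      by (rule measurable_compose_rev)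
  next
    fix \<phi> :: "real \<Rightarrow> real" assume "continuous_on UNIV \<phi> \<and> bounded (range \<phi>)"
    then obtain B where cont: "continuous_on UNIV \<phi>" and B: "\<And>z. \<bar>\<phi> z\<bar> \<le> B"
      by (auto simp: bounded_iff)
    have cont': "continuous_on UNIV (\<lambda>z. - \<phi> z)" and B': "\<And>z. \<bar>- \<phi> z\<bar> \<le> B"
      using cont B by (auto intro: continuous_intros)
    show "(\<lambda>n. outer_expectation M (\<lambda>\<omega>. ereal (\<phi> (Z n \<omega>))))
        \<longlonglongrightarrow> ereal (\<integral>\<omega>. \<phi> (inf_deriv f (G \<omega>)) \<partial>N)"
    proof (rule order_tendstoI)
      \<comment> \<open>By \<open>bracket\<close>, \<open>Z n\<close> lies in the segment, so the
        supremum of \<phi> over it is a bound that depends on \<open>Y n\<close> alone.\<close>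
      fix c assume "ereal (\<integral>\<omega>. \<phi> (inf_deriv f (G \<omega>)) \<partial>N) < c"
      then show "\<forall>\<^sub>F n in sequentially. outer_expectation M (\<lambda>\<omega>. ereal (\<phi> (Z n \<omega>))) < c"
      proof (rule hj_eventually_less[OF hjY N seg_cont[OF cont B] abs_segment_sup_le[OF B]
            seg_lim[OF cont B], rotated])
        fix k
        show "\<forall>\<^sub>F n in sequentially. AE \<omega> in M.
            ereal (\<phi> (Z n \<omega>)) \<le> ereal (segment_sup \<phi> (q k (Y n \<omega>), inf_deriv f (Y n \<omega>)))"
          using bracket[of k]
        proof eventually_elim
          case (elim n)
          then show ?case
            by eventually_elim (auto intro: le_segment_sup[OF B])
        qed
      qed
    next
      \<comment> \<open>The lower bound is the infimum of \<phi> over the segment, written as minus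
        the supremum of its negative so that the same lemmas apply.\<close>
      fix c assume c: "c < ereal (\<integral>\<omega>. \<phi> (inf_deriv f (G \<omega>)) \<partial>N)"
      show "\<forall>\<^sub>F n in sequentially. c < outer_expectation M (\<lambda>\<omega>. ereal (\<phi> (Z n \<omega>)))"
      proof (rule hj_eventually_greater[OF hjY N, where
            U = "\<lambda>k g. - segment_sup (\<lambda>z. - \<phi> z) (q k g, inf_deriv f g)" and B = B])
        fix k
        show "\<forall>\<^sub>F n in sequentially. AE \<omega> in M.
            ereal (- segment_sup (\<lambda>z. - \<phi> z) (q k (Y n \<omega>), inf_deriv f (Y n \<omega>))) \<le> ereal (\<phi> (Z n \<omega>))"
          using bracket[of k]
        proof eventually_elim
          case (elim n)
          then show ?case
          proof eventually_elim
            case (elim \<omega>)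
            then have "- \<phi> (Z n \<omega>) \<le> segment_sup (\<lambda>z. - \<phi> z) (q k (Y n \<omega>), inf_deriv f (Y n \<omega>))"
              by (intro le_segment_sup[OF B']) auto
            then show ?case by simp
          qed
        qed
        show "continuous_on UNIV (\<lambda>g. - segment_sup (\<lambda>z. - \<phi> z) (q k g, inf_deriv f g))"
          by (intro continuous_on_minus seg_cont[OF cont' B'])
        show "\<bar>- segment_sup (\<lambda>z. - \<phi> z) (q k g, inf_deriv f g)\<bar> \<le> B" for g
          using abs_segment_sup_le[OF B'] by simp
      next
        show "(\<lambda>k. - segment_sup (\<lambda>z. - \<phi> z) (q k g, inf_deriv f g)) \<longlonglongrightarrow> \<phi> (inf_deriv f g)" for g
          using tendsto_minus[OF seg_lim[OF cont' B', of g]] by simp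
      qed (rule c)
    qed
  qed

  have negl: "outer_negligible M (\<lambda>n \<omega>. Z n \<omega> - inf_deriv f (Y n \<omega>))"
    unfolding outer_negligible_def
  proof (intro allI impI)
    fix \<eta> :: real assume \<eta>: "\<eta> > 0"
    let ?A = "\<lambda>n. {\<omega> \<in> space M. \<bar>Z n \<omega> - inf_deriv f (Y n \<omega>)\<bar> > \<eta>}"
    \<comment> \<open>A Markov-type majorant of the indicator: \<open>bracket\<close> bounds the
      error by the gap between \<open>inf_deriv f\<close> and \<open>q k\<close>, so a large error
      forces the value 1. Truncation at 1 makes it bounded, and it vanishes as \<open>k\<close>
      grows because the gap closes.\<close>
    define U where "U k g = min 1 ((inf_deriv f g - q k g) / \<eta>)" for k g
    show "(\<lambda>n. outer_prob M (?A n)) \<longlonglongrightarrow> 0"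
    proof (rule order_tendstoI)
      fix c :: ereal assume "c < 0"
      then show "\<forall>\<^sub>F n in sequentially. c < outer_prob M (?A n)"
        by (intro always_eventually allI less_le_trans[OF _ outer_prob_nonneg])
    next
      fix c :: ereal assume c: "0 < c"
      show "\<forall>\<^sub>F n in sequentially. outer_prob M (?A n) < c"
        unfolding outer_prob_def
      proof (rule hj_eventually_less[OF hjY N, where U = U and B = 1 and u = "\<lambda>_. 0"])
        fix k
        show "continuous_on UNIV (U k)"
          unfolding U_def using \<eta> by (intro continuous_intros cont_q cont_d) auto
        have U0: "0 \<le> U k g" for g
          unfolding U_def using \<eta> q_le by simp
        show "\<bar>U k g\<bar> \<le> 1" for g
          using U0[of g] by (simp add: U_def)
        show "\<forall>\<^sub>F n in sequentially. AE \<omega> in M. indicator (?A n) \<omega> \<le> ereal (U k (Y n \<omega>))"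
          using bracket[of k]
        proof eventually_elim
          case (elim n)
          then show ?case
          proof eventually_elim
            case (elim \<omega>)
            show ?case
            proof (cases "\<omega> \<in> ?A n")
              case True
              with elim have "\<eta> < inf_deriv f (Y n \<omega>) - q k (Y n \<omega>)" by auto
              with \<eta> have "U k (Y n \<omega>) = 1" by (simp add: U_def)
              with True show ?thesis by simp
            qed (use U0 in simp)
          qed
        qed
      next
        fix g
        have "(\<lambda>k. U k g) \<longlonglongrightarrow> min 1 ((inf_deriv f g - inf_deriv f g) / \<eta>)"
          unfolding U_def using \<eta> by (intro tendsto_intros q_lim) auto
        then show "(\<lambda>k. U k g) \<longlonglongrightarrow> 0" by simp
      qed (use c in \<open>simp add: zero_ereal_def\<close>)
    qed
  qed
  show ?thesis
    using conv negl unfolding Z_def Y_def by (rule conjI)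
qed

end
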